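(* Let $n \ge 3$ and let $\boldsymbol{a} = (a_1, a_2, \ldots, a_n)^T$ be a vector of positive integers with $a_1 \le a_2 \le \cdots \le a_n$ whose entries are pairwise coprime, i.e. $\gcd(a_i,a_j)=1$ for all $i,j \in \{1,\ldots,n\}$ with $i \neq j$. Then $$F(\boldsymbol{a}) \le \frac{1}{2}\left(\sqrt{\frac{1}{3}(a_1+a_2+a_3)(a_1+a_2+a_3+2a_1a_2a_3)+\frac{8}{3}(a_1a_2+a_2a_3+a_3a_1)}-a_1-a_2-a_3\right).$$
   Context: For a vector $\boldsymbol{a}=(a_1,\ldots,a_n)^T$ of positive integers with $n\ge 2$ and $\gcd(a_1,\ldots,a_n)=1$, the Frobenius number is $F(\boldsymbol{a}) := \max\{ b \in \mathbb{Z} : b \ne \sum_{i=1}^n a_i z_i \text{ for all } (z_1,\ldots,z_n) \in \mathbb{Z}_{\ge 0}^n \}$, the largest integer (possibly negative) that is not a nonnegative integer combination of the $a_i$. In particular $F(\boldsymbol{a})=-1$ when some $a_i=1$. *)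

theory Defs
  imports Complex_Main
begin

(* The vector (a_1, ..., a_n) is a function on indices 1..n; values outside are irrelevant.
   The set below is unbounded from below, so Max does not apply. Its greatest element exists
   whenever n >= 1, all a_i are positive and their gcd is 1; otherwise the value is unspecified. *)
definition frobenius_number :: "nat \<Rightarrow> (nat \<Rightarrow> nat) \<Rightarrow> int" where
  "frobenius_number n a =
     (GREATEST b :: int. \<forall>z :: nat \<Rightarrow> nat. b \<noteq> int (\<Sum>i = 1..n. a i * z i))"

end

theory Submission
  imports Defs "HOL-Number_Theory.Cong"
begin

text \<open>
  It suffices to use the first three generators \<open>a, b, c\<close>. Put \<open>M = a b c\<close>, \<open>s = a + b + c\<close>, and for an
  unrepresentable \<open>N \<ge> 0\<close> consider all \<open>(x, y, z)\<close> in the box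
  \<open>[0, b c) \<times> [0, c a) \<times> [0, a b)\<close> with \<open>a x + b y + c z \<equiv> N\<close> modulo \<open>M\<close>. There are \<open>M\<close> of them, and
  each satisfies \<open>N - (a x + b y + c z) \<in> {-M, -2 M}\<close>, so in coordinates \<open>X, Y, Z\<close> centred at the
  (doubled) middle of the box \<open>(2 N + s - a X - b Y - c Z)\<^sup>2 = M\<^sup>2\<close>. Summing over the solutions, the
  linear terms vanish by equidistribution of each coordinate, the squares are explicit, and the
  mixed sum of \<open>X Y\<close>, which reduces to \<open>\<Sum>\<^sub>r \<rho>(r) \<rho>(\<pi> r)\<close> with \<open>\<rho>(r) = 2 r - (c - 1)\<close> and a permutation
  \<open>\<pi>\<close> of the residues modulo \<open>c\<close> (up to the factor \<open>a b\<close>), is at least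
  \<open>- \<Sum>\<^sub>r \<rho>(r)\<^sup>2\<close>. This gives \<open>3 (2 N + s)\<^sup>2 \<le> s\<^sup>2 + 2 M s - 4 (a b + b c + c a)\<close>.
\<close>

section \<open>Power sums and centred coordinates on an interval\<close>

lemma sum_int_lessThan:
  fixes m :: int
  assumes "0 \<le> m"
  shows "2 * (\<Sum>x\<in>{0..<m}. x) = m * (m - 1)"
  using assms
proof (induction m rule: int_ge_induct)
  case (step i)
  then have "{0..<i + 1} = insert i {0..<i}" by auto
  with step show ?case by (simp add: algebra_simps)
qed simp

lemma sum_int_squares_lessThan:
  fixes m :: int
  assumes "0 \<le> m"
  shows "6 * (\<Sum>x\<in>{0..<m}. x^2) = m * (m - 1) * (2 * m - 1)"
  using assms
proof (induction m rule: int_ge_induct)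
  case (step i)
  then have "{0..<i + 1} = insert i {0..<i}" by auto
  with step show ?case by (simp add: algebra_simps power2_eq_square)
qed simp

text \<open>Twice the offset from the midpoint \<open>(m - 1) / 2\<close> of \<open>{0..<m}\<close>;
  the doubling keeps it integral.\<close>

definition centred :: "int \<Rightarrow> int \<Rightarrow> int" where
  "centred m x = 2 * x - (m - 1)"

lemma sum_centred:
  assumes "0 \<le> m"
  shows "(\<Sum>x\<in>{0..<m}. centred m x) = 0"
  using sum_int_lessThan[OF assms] assms
  by (simp add: centred_def sum_subtractf sum_distrib_left[symmetric])

lemma sum_centred_squares:
  assumes "0 \<le> m"
  shows "3 * (\<Sum>x\<in>{0..<m}. (centred m x)^2) = m * (m^2 - 1)"
proof -
  have "(\<Sum>x\<in>{0..<m}. (centred m x)^2) =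
      (\<Sum>x\<in>{0..<m}. 4 * x^2 - 4 * (m - 1) * x + (m - 1)^2)"
    by (rule sum.cong) (simp_all add: centred_def power2_eq_square algebra_simps)
  also have "\<dots> = 4 * (\<Sum>x\<in>{0..<m}. x^2) - 4 * (m - 1) * (\<Sum>x\<in>{0..<m}. x) + m * (m - 1)^2"
    using assms by (simp add: sum.distrib sum_subtractf sum_distrib_left)
  finally have "3 * (\<Sum>x\<in>{0..<m}. (centred m x)^2) =
      2 * (6 * (\<Sum>x\<in>{0..<m}. x^2)) - 6 * (m - 1) * (2 * (\<Sum>x\<in>{0..<m}. x)) + 3 * m * (m - 1)^2"
    by (simp add: algebra_simps)
  also have "\<dots> = m * (m^2 - 1)"
    unfolding sum_int_lessThan[OF assms] sum_int_squares_lessThan[OF assms]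
    by (simp add: algebra_simps power2_eq_square)
  finally show ?thesis .
qed

section \<open>Splitting an interval into residue classes\<close>

lemma sum_residue_classes:
  fixes b c :: int and f :: "int \<Rightarrow> int"
  assumes "0 < b" "0 < c"
  shows "(\<Sum>x\<in>{0..<b * c}. f x) = (\<Sum>r\<in>{0..<c}. \<Sum>i\<in>{0..<b}. f (r + c * i))"
proof -
  have "(\<Sum>r\<in>{0..<c}. \<Sum>i\<in>{0..<b}. f (r + c * i)) =
      (\<Sum>(r, i)\<in>{0..<c} \<times> {0..<b}. f (r + c * i))"
    by (simp add: sum.cartesian_product)
  also have "\<dots> = (\<Sum>x\<in>{0..<b * c}. f x)"
  proof (rule sum.reindex_bij_witness[where i = "\<lambda>x. (x mod c, x div c)" and j = "\<lambda>(r, i). r + c * i"])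
    fix p assume "p \<in> {0..<c} \<times> {0..<b}"
    then obtain r i where p: "p = (r, i)" "0 \<le> r" "r < c" "0 \<le> i" "i < b" by auto
    have "c * (i + 1) \<le> c * b" using p assms by (intro mult_left_mono) auto
    then have "r + c * i < b * c" using p by (simp add: algebra_simps)
    then show "(case p of (r, i) \<Rightarrow> r + c * i) \<in> {0..<b * c}" using p assms by simp
  next
    fix x assume "x \<in> {0..<b * c}"
    then have x: "0 \<le> x" "x < b * c" by auto
    have "x div c * c \<le> x" using assms by (metis div_mult_mod_eq le_add_same_cancel1 pos_mod_sign)
    then have "x div c * c < b * c" using x by linarith
    then have "x div c < b" using assms by simp
    then show "(x mod c, x div c) \<in> {0..<c} \<times> {0..<b}"
      using x assms by (simp add: pos_imp_zdiv_nonneg_iff)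
  qed auto
  finally show ?thesis by simp
qed

text \<open>The class of \<open>r\<close> in \<open>{0..<b * c}\<close> is an arithmetic progression
  whose midpoint lies as far from the middle of the long interval as \<open>r\<close> does from the
  middle of \<open>{0..<c}\<close>. So sums over classes reduce to centred residues modulo
  \<open>c\<close>.\<close>

lemma sum_centred_residue_class:
  assumes "0 < b"
  shows "(\<Sum>i\<in>{0..<b}. centred (b * c) (r + c * i)) = b * centred c r"
proof -
  have "(\<Sum>i\<in>{0..<b}. centred (b * c) (r + c * i)) =
      (\<Sum>i\<in>{0..<b}. 2 * c * i + (2 * r - (b * c - 1)))"
    by (rule sum.cong) (simp_all add: centred_def algebra_simps)
  also have "\<dots> = c * (2 * (\<Sum>i\<in>{0..<b}. i)) + b * (2 * r - (b * c - 1))"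
    using assms by (simp add: sum.distrib sum_distrib_left mult.assoc mult.left_commute)
  also have "\<dots> = c * (b * (b - 1)) + b * (2 * r - (b * c - 1))"
    using assms by (simp add: sum_int_lessThan)
  finally show ?thesis by (simp add: centred_def algebra_simps)
qed

section \<open>Solutions of the linear congruence and their moments\<close>

text \<open>The projection of \<open>triple_solutions\<close> to the first two coordinates: once
  \<open>z\<close> is forgotten, only the condition modulo \<open>c\<close> survives.\<close>

definition pair_solutions :: "int \<Rightarrow> int \<Rightarrow> int \<Rightarrow> int \<Rightarrow> (int \<times> int) set" where
  "pair_solutions a b c N =
     {(x, y). x \<in> {0..<b * c} \<and> y \<in> {0..<a * c} \<and> c dvd N - a * x - b * y}"

definition triple_solutions :: "int \<Rightarrow> int \<Rightarrow> int \<Rightarrow> int \<Rightarrow> (int \<times> int \<times> int) set" where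
  "triple_solutions a b c N =
     {(x, y, z). x \<in> {0..<b * c} \<and> y \<in> {0..<c * a} \<and> z \<in> {0..<a * b} \<and>
        a * b * c dvd N - a * x - b * y - c * z}"

text \<open>Cyclic symmetry: moments need only be computed for \<open>x\<close> and for the pair
  \<open>x\<close>, \<open>y\<close>.\<close>

lemma sum_triple_solutions_rotate:
  "(\<Sum>(x, y, z)\<in>triple_solutions a b c N. f y z x) =
     (\<Sum>(x, y, z)\<in>triple_solutions b c a N. f x y (z :: int) :: int)"
  by (rule sum.reindex_bij_witness[where i = "\<lambda>(x, y, z). (z, x, y)" and j = "\<lambda>(x, y, z). (y, z, x)"])
     (auto simp: triple_solutions_def algebra_simps)

text \<open>If \<open>N - a * x - b * y = w * c\<close>, the condition on \<open>z\<close> becomes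
  \<open>a * b dvd w - z\<close>, which has exactly one solution in \<open>{0..<a * b}\<close>.
  Hence the projection is bijective.\<close>

lemma sum_triple_solutions_pair:
  assumes "0 < a" "0 < b" "0 < c"
  shows "(\<Sum>(x, y, z)\<in>triple_solutions a b c N. f x y) =
     (\<Sum>(x, y)\<in>pair_solutions a b c N. f x y :: int)"
proof -
  have key: "a * b * c dvd w * c - c * z \<longleftrightarrow> a * b dvd w - z" for w z
  proof -
    have "w * c - c * z = (w - z) * c" by (simp add: algebra_simps)
    then show ?thesis using assms by simp
  qed
  show ?thesis
  proof (rule sum.reindex_bij_witness[where
        i = "\<lambda>(x, y). (x, y, ((N - a * x - b * y) div c) mod (a * b))" and j = "\<lambda>(x, y, z). (x, y)"])
    fix t assume t: "t \<in> triple_solutions a b c N"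
    obtain x y z where xyz: "t = (x, y, z)" by (cases t)
    have d: "a * b * c dvd N - a * x - b * y - c * z" and z: "0 \<le> z" "z < a * b"
      using t by (auto simp: triple_solutions_def xyz)
    have "c dvd N - a * x - b * y - c * z" using d by (rule dvd_trans[rotated]) simp
    then have "c dvd N - a * x - b * y" by (metis dvd_triv_left dvd_diff_left_iff)
    then obtain w where w: "N - a * x - b * y = w * c" by (auto simp: dvd_def mult.commute)
    have "a * b dvd w - z" using d by (simp add: w key)
    then have "w mod (a * b) = z" using z by (metis mod_eq_dvd_iff mod_pos_pos_trivial)
    then show "(case case t of (x, y, z) \<Rightarrow> (x, y) of
            (x, y) \<Rightarrow> (x, y, ((N - a * x - b * y) div c) mod (a * b))) = t"
      using assms by (simp add: xyz w)
    show "(case t of (x, y, z) \<Rightarrow> (x, y)) \<in> pair_solutions a b c N"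
      using t by (auto simp: triple_solutions_def pair_solutions_def xyz w mult.commute)
    show "(case case t of (x, y, z) \<Rightarrow> (x, y) of (x, y) \<Rightarrow> f x y) = (case t of (x, y, z) \<Rightarrow> f x y)"
      by (simp add: xyz)
  next
    fix p assume p: "p \<in> pair_solutions a b c N"
    obtain x y where xy: "p = (x, y)" by (cases p)
    obtain w where w: "N - a * x - b * y = w * c"
      using p by (auto simp: pair_solutions_def xy dvd_def mult.commute)
    show "(case p of (x, y) \<Rightarrow> (x, y, ((N - a * x - b * y) div c) mod (a * b))) \<in> triple_solutions a b c N"
      using p assms by (auto simp: triple_solutions_def pair_solutions_def xy w key mult.commute[of a c])
  qed auto
qed

text \<open>An inverse of \<open>b\<close> modulo \<open>c\<close> solves the congruence for
  \<open>s\<close>; invertibility of \<open>a\<close> makes the solution injective in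
  \<open>r\<close>, hence a permutation of the residues.\<close>

lemma linear_cong_bij:
  fixes a b c N :: int
  assumes "0 < c" "coprime a c" "coprime b c"
  obtains \<pi> where "bij_betw \<pi> {0..<c} {0..<c}"
    "\<And>r s. r \<in> {0..<c} \<Longrightarrow> s \<in> {0..<c} \<Longrightarrow> c dvd N - a * r - b * s \<longleftrightarrow> s = \<pi> r"
proof -
  obtain b' where b': "[b * b' = 1] (mod c)" using assms(3) cong_solve_coprime_int by blast
  define \<pi> where "\<pi> r = (b' * (N - a * r)) mod c" for r
  have iff: "c dvd N - a * r - b * s \<longleftrightarrow> s = \<pi> r" if "s \<in> {0..<c}" for r s
  proof -
    have "c dvd N - a * r - b * s \<longleftrightarrow> [N - a * r = b * s] (mod c)"
      by (simp add: cong_iff_dvd_diff)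
    also have "\<dots> \<longleftrightarrow> [b' * (N - a * r) = s] (mod c)"
    proof
      assume "[N - a * r = b * s] (mod c)"
      then have "[b' * (N - a * r) = (b * b') * s] (mod c)"
        using cong_scalar_left[of "N - a * r" "b * s" c b'] by (simp add: mult_ac)
      also have "[(b * b') * s = 1 * s] (mod c)" by (rule cong_scalar_right[OF b'])
      finally show "[b' * (N - a * r) = s] (mod c)" by simp
    next
      assume "[b' * (N - a * r) = s] (mod c)"
      then have "[b * s = (b * b') * (N - a * r)] (mod c)"
        using cong_scalar_left[of "b' * (N - a * r)" s c b] by (simp add: mult_ac cong_sym)
      also have "[(b * b') * (N - a * r) = 1 * (N - a * r)] (mod c)" by (rule cong_scalar_right[OF b'])
      finally show "[N - a * r = b * s] (mod c)" by (simp add: cong_sym)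
    qed
    also have "\<dots> \<longleftrightarrow> s = \<pi> r" using that by (auto simp: cong_def \<pi>_def)
    finally show ?thesis .
  qed
  have maps: "\<pi> r \<in> {0..<c}" for r using assms by (simp add: \<pi>_def)
  have "inj_on \<pi> {0..<c}"
  proof (rule inj_onI)
    fix r s assume rs: "r \<in> {0..<c}" "s \<in> {0..<c}" "\<pi> r = \<pi> s"
    have "c dvd (N - a * r - b * \<pi> r) - (N - a * s - b * \<pi> r)"
      using iff[of "\<pi> r" r, OF maps] iff[of "\<pi> r" s, OF maps] rs(3) by (simp only: dvd_diff)
    then have "c dvd a * (s - r)" by (simp add: algebra_simps)
    then have "c dvd s - r" using assms(2) by (simp add: coprime_dvd_mult_right_iff coprime_commute)
    then have "s mod c = r mod c" by (simp add: mod_eq_dvd_iff)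
    then show "r = s" using rs by simp
  qed
  moreover have "\<pi> ` {0..<c} \<subseteq> {0..<c}" using maps by auto
  ultimately have "bij_betw \<pi> {0..<c} {0..<c}"
    by (simp add: bij_betw_def endo_inj_surj)
  then show ?thesis using that iff by blast
qed

text \<open>The congruence sees only residues modulo \<open>c\<close>, and that of \<open>x\<close>
  determines that of \<open>y\<close>. Within the two classes \<open>x\<close> and \<open>y\<close>
  vary independently, so sums of products factor class by class.\<close>

lemma sum_pair_solutions:
  assumes "0 < a" "0 < b" "0 < c" "coprime a c" "coprime b c"
  obtains \<pi> where "bij_betw \<pi> {0..<c} {0..<c}"
    "\<And>f g. (\<Sum>(x, y)\<in>pair_solutions a b c N. f x * g y) =
       (\<Sum>r\<in>{0..<c}. (\<Sum>i\<in>{0..<b}. f (r + c * i)) * (\<Sum>j\<in>{0..<a}. g (\<pi> r + c * j)) :: int)"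
proof -
  obtain \<pi> where bij: "bij_betw \<pi> {0..<c} {0..<c}" and
    iff: "\<And>r s. r \<in> {0..<c} \<Longrightarrow> s \<in> {0..<c} \<Longrightarrow> c dvd N - a * r - b * s \<longleftrightarrow> s = \<pi> r"
    using linear_cong_bij[OF assms(3-5), of N] by blast
  have eq: "(\<Sum>(x, y)\<in>pair_solutions a b c N. f x * g y) =
       (\<Sum>r\<in>{0..<c}. (\<Sum>i\<in>{0..<b}. f (r + c * i)) * (\<Sum>j\<in>{0..<a}. g (\<pi> r + c * j)))"
    for f g :: "int \<Rightarrow> int"
  proof -
    let ?D = "\<lambda>x y. c dvd N - a * x - b * y"
    have "(\<Sum>(x, y)\<in>pair_solutions a b c N. f x * g y) =
        (\<Sum>(x, y)\<in>{0..<b * c} \<times> {0..<a * c}. if ?D x y then f x * g y else 0)"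
      by (rule sum.mono_neutral_cong_left) (auto simp: pair_solutions_def split: if_splits)
    also have "\<dots> = (\<Sum>x\<in>{0..<b * c}. \<Sum>y\<in>{0..<a * c}. if ?D x y then f x * g y else 0)"
      by (simp add: sum.cartesian_product)
    also have "\<dots> = (\<Sum>r\<in>{0..<c}. \<Sum>i\<in>{0..<b}. \<Sum>s\<in>{0..<c}. \<Sum>j\<in>{0..<a}.
        if ?D (r + c * i) (s + c * j) then f (r + c * i) * g (s + c * j) else 0)"
      using assms by (simp add: sum_residue_classes)
    also have "\<dots> = (\<Sum>r\<in>{0..<c}. \<Sum>i\<in>{0..<b}. \<Sum>s\<in>{0..<c}.
        if s = \<pi> r then \<Sum>j\<in>{0..<a}. f (r + c * i) * g (s + c * j) else 0)"
    proof (intro sum.cong refl)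
      fix r i s assume rs: "r \<in> {0..<c}" "s \<in> {0..<c}"
      have "?D (r + c * i) (s + c * j) \<longleftrightarrow> s = \<pi> r" for j
      proof -
        have "N - a * (r + c * i) - b * (s + c * j) = (N - a * r - b * s) - c * (a * i + b * j)"
          by (simp add: algebra_simps)
        then have "?D (r + c * i) (s + c * j) \<longleftrightarrow> ?D r s"
          by (metis dvd_diff_left_iff dvd_triv_left)
        then show ?thesis using iff rs by simp
      qed
      then show "(\<Sum>j\<in>{0..<a}. if ?D (r + c * i) (s + c * j) then f (r + c * i) * g (s + c * j) else 0) =
          (if s = \<pi> r then \<Sum>j\<in>{0..<a}. f (r + c * i) * g (s + c * j) else 0)" by simp
    qed
    also have "\<dots> = (\<Sum>r\<in>{0..<c}. \<Sum>i\<in>{0..<b}. \<Sum>j\<in>{0..<a}. f (r + c * i) * g (\<pi> r + c * j))"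
      using bij_betwE[OF bij] by - (rule sum.cong[OF refl], rule sum.cong[OF refl], simp add: sum.delta)
    also have "\<dots> = (\<Sum>r\<in>{0..<c}. (\<Sum>i\<in>{0..<b}. f (r + c * i)) * (\<Sum>j\<in>{0..<a}. g (\<pi> r + c * j)))"
      by (simp add: sum_product)
    finally show ?thesis .
  qed
  show ?thesis using that[OF bij] eq by blast
qed

text \<open>The weights \<open>a^2\<close> and \<open>a * b\<close> are those occurring when the
  square of the linear form is expanded; they also turn the right-hand sides into expressions in
  \<open>a * b * c\<close>, which is invariant under rotation.\<close>

lemma triple_solutions_moments:
  assumes "0 < a" "0 < b" "0 < c" "coprime a c" "coprime b c"
  shows "(\<Sum>(x, y, z)\<in>triple_solutions a b c N. 1) = a * b * c"
    and "(\<Sum>(x, y, z)\<in>triple_solutions a b c N. centred (b * c) x) = 0"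
    and "3 * a^2 * (\<Sum>(x, y, z)\<in>triple_solutions a b c N. (centred (b * c) x)^2) =
           a * b * c * ((a * b * c)^2 - a^2)"
    and "3 * (a * b) * (\<Sum>(x, y, z)\<in>triple_solutions a b c N. centred (b * c) x * centred (c * a) y) \<ge>
           - (a * b * c * (a * b * c * c - a * b))"
proof -
  obtain \<pi> where bij: "bij_betw \<pi> {0..<c} {0..<c}" and
    eq: "\<And>f g. (\<Sum>(x, y)\<in>pair_solutions a b c N. f x * g y) =
       (\<Sum>r\<in>{0..<c}. (\<Sum>i\<in>{0..<b}. f (r + c * i)) * (\<Sum>j\<in>{0..<a}. g (\<pi> r + c * j)) :: int)"
    using sum_pair_solutions[OF assms, of N] by blast
  \<comment> \<open>Each \<open>x\<close> in its range belongs to exactly \<open>a\<close>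
    solutions, so the coordinate is equidistributed.\<close>
  have eqx: "(\<Sum>(x, y, z)\<in>triple_solutions a b c N. f x) = a * (\<Sum>x\<in>{0..<b * c}. f x)" for f :: "int \<Rightarrow> int"
  proof -
    have "(\<Sum>(x, y, z)\<in>triple_solutions a b c N. f x) = (\<Sum>(x, y)\<in>pair_solutions a b c N. f x)"
      using assms by (intro sum_triple_solutions_pair)
    also have "\<dots> = (\<Sum>r\<in>{0..<c}. (\<Sum>i\<in>{0..<b}. f (r + c * i)) * a)"
      using eq[of f "\<lambda>_. 1"] assms by simp
    also have "\<dots> = a * (\<Sum>x\<in>{0..<b * c}. f x)"
      using assms by (simp add: sum_residue_classes sum_distrib_left mult.commute)
    finally show ?thesis .
  qed
  show "(\<Sum>(x, y, z)\<in>triple_solutions a b c N. 1) = a * b * c"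
    using eqx[of "\<lambda>_. 1"] assms by simp
  show "(\<Sum>(x, y, z)\<in>triple_solutions a b c N. centred (b * c) x) = 0"
    using assms by (simp add: eqx sum_centred)
  have "3 * a^2 * (\<Sum>(x, y, z)\<in>triple_solutions a b c N. (centred (b * c) x)^2) =
      a^3 * (3 * (\<Sum>x\<in>{0..<b * c}. (centred (b * c) x)^2))"
    by (simp add: eqx power2_eq_square power3_eq_cube)
  also have "3 * (\<Sum>x\<in>{0..<b * c}. (centred (b * c) x)^2) = b * c * ((b * c)^2 - 1)"
    using assms by (intro sum_centred_squares) simp
  also have "a^3 * (b * c * ((b * c)^2 - 1)) = a * b * c * ((a * b * c)^2 - a^2)"
    by (simp add: power2_eq_square power3_eq_cube algebra_simps)
  finally show "3 * a^2 * (\<Sum>(x, y, z)\<in>triple_solutions a b c N. (centred (b * c) x)^2) =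
      a * b * c * ((a * b * c)^2 - a^2)" .
  let ?Q = "\<Sum>r\<in>{0..<c}. (centred c r)^2"
  let ?R = "\<Sum>r\<in>{0..<c}. centred c r * centred c (\<pi> r)"
  have "(\<Sum>(x, y, z)\<in>triple_solutions a b c N. centred (b * c) x * centred (c * a) y) =
      (\<Sum>(x, y)\<in>pair_solutions a b c N. centred (b * c) x * centred (a * c) y)"
    using assms by (subst sum_triple_solutions_pair) (simp_all add: mult.commute)
  also have "\<dots> = a * b * ?R"
    unfolding eq sum_centred_residue_class[OF assms(1)] sum_centred_residue_class[OF assms(2)]
    by (simp add: sum_distrib_left mult_ac)
  finally have XY: "(\<Sum>(x, y, z)\<in>triple_solutions a b c N. centred (b * c) x * centred (c * a) y) = a * b * ?R" .
  \<comment> \<open>Since \<open>\<pi>\<close> is a permutation, this sum of squares is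
    \<open>2 * ?Q + 2 * ?R\<close>, giving \<open>?R \<ge> - ?Q\<close>; the reversal of the
    residues would attain equality.\<close>
  have "0 \<le> (\<Sum>r\<in>{0..<c}. (centred c r + centred c (\<pi> r))^2)" by (intro sum_nonneg) simp
  also have "\<dots> = ?Q + (\<Sum>r\<in>{0..<c}. (centred c (\<pi> r))^2) + 2 * ?R"
    by (simp add: power2_sum sum.distrib sum_distrib_left mult.assoc)
  also have "(\<Sum>r\<in>{0..<c}. (centred c (\<pi> r))^2) = ?Q"
    by (rule sum.reindex_bij_betw[OF bij])
  finally have "- (3 * ?Q) \<le> 3 * ?R" by simp
  then have "- (c * (c^2 - 1)) \<le> 3 * ?R" using assms by (simp add: sum_centred_squares)
  then have "(a * b)^2 * - (c * (c^2 - 1)) \<le> (a * b)^2 * (3 * ?R)" by (rule mult_left_mono) simp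
  then show "3 * (a * b) * (\<Sum>(x, y, z)\<in>triple_solutions a b c N. centred (b * c) x * centred (c * a) y) \<ge>
      - (a * b * c * (a * b * c * c - a * b))"
    unfolding XY by (simp add: power2_eq_square algebra_simps)
qed

section \<open>The quadratic bound for nonnegative unrepresentable integers\<close>

lemma unrepresentable_bound:
  fixes a b c N :: int
  assumes pos: "0 < a" "0 < b" "0 < c"
    and coprime: "coprime a b" "coprime b c" "coprime c a"
    and "0 \<le> N"
    and unrepresentable: "\<And>x y z. 0 \<le> x \<Longrightarrow> 0 \<le> y \<Longrightarrow> 0 \<le> z \<Longrightarrow> N \<noteq> a * x + b * y + c * z"
  shows "3 * (2 * N + a + b + c)^2 \<le>
    (a + b + c)^2 + 2 * (a * b * c) * (a + b + c) - 4 * (a * b + b * c + c * a)"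
proof -
  let ?S = "\<lambda>f. \<Sum>(x, y, z)\<in>triple_solutions a b c N. f x y z"
  let ?X = "centred (b * c)" and ?Y = "centred (c * a)" and ?Z = "centred (a * b)"
  define M where "M = a * b * c"
  define \<tau> where "\<tau> = 2 * N + a + b + c"
  have "0 < M" and M: "b * c * a = M" "c * a * b = M" "a * b * c = M"
    using pos by (simp_all add: M_def)
  \<comment> \<open>The rotations rewrite sums over the solution sets of \<open>(b, c, a)\<close>
    and \<open>(c, a, b)\<close> as \<open>?S\<close>, so that the moment lemma also covers the
    coordinates \<open>y\<close> and \<open>z\<close>.\<close>
  have rot1: "?S f = (\<Sum>(y, z, x)\<in>triple_solutions b c a N. f x y z)" for f :: "int \<Rightarrow> int \<Rightarrow> int \<Rightarrow> int"
    by (rule sum_triple_solutions_rotate[of "\<lambda>y z x. f x y z"])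
  have rot2: "?S f = (\<Sum>(z, x, y)\<in>triple_solutions c a b N. f x y z)" for f :: "int \<Rightarrow> int \<Rightarrow> int \<Rightarrow> int"
    unfolding rot1 by (rule sum_triple_solutions_rotate[of "\<lambda>z x y. f x y z"])
  note m1 = triple_solutions_moments[of a b c N, unfolded M]
  note m2 = triple_solutions_moments[of b c a N, unfolded M, folded rot1]
  note m3 = triple_solutions_moments[of c a b N, unfolded M, folded rot2]
  have cop: "coprime a c" "coprime b c" "coprime b a" "coprime c a" "coprime c b" "coprime a b"
    using coprime by (auto simp: coprime_commute)
  have one: "?S (\<lambda>_ _ _. 1) = M" using m1(1) pos cop by simp
  have lin: "?S (\<lambda>x y z. ?X x) = 0" "?S (\<lambda>x y z. ?Y y) = 0" "?S (\<lambda>x y z. ?Z z) = 0"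
    using m1(2) m2(2) m3(2) pos cop by simp_all
  have sq: "3 * a^2 * ?S (\<lambda>x y z. (?X x)^2) = M * (M^2 - a^2)"
    "3 * b^2 * ?S (\<lambda>x y z. (?Y y)^2) = M * (M^2 - b^2)"
    "3 * c^2 * ?S (\<lambda>x y z. (?Z z)^2) = M * (M^2 - c^2)"
    using m1(3) m2(3) m3(3) pos cop by simp_all
  have mixed: "3 * (a * b) * ?S (\<lambda>x y z. ?X x * ?Y y) \<ge> - (M * (M * c - a * b))"
    "3 * (b * c) * ?S (\<lambda>x y z. ?Y y * ?Z z) \<ge> - (M * (M * a - b * c))"
    "3 * (c * a) * ?S (\<lambda>x y z. ?Z z * ?X x) \<ge> - (M * (M * b - c * a))"
    using m1(4) m2(4) m3(4) pos cop by simp_all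
  \<comment> \<open>Put \<open>N - (a x + b y + c z) = k M\<close>. Unrepresentability forces \<open>k < 0\<close> and the size of
    the box forces \<open>k > -3\<close>, while the base below is \<open>(2 k + 3) M\<close>.\<close>
  have "(\<tau> - a * ?X x - b * ?Y y - c * ?Z z)^2 = M^2"
    if "(x, y, z) \<in> triple_solutions a b c N" for x y z
  proof -
    from that have bnd: "0 \<le> x" "x \<le> b * c - 1" "0 \<le> y" "y \<le> c * a - 1" "0 \<le> z" "z \<le> a * b - 1"
      and "M dvd N - a * x - b * y - c * z"
      by (auto simp: triple_solutions_def M_def)
    then obtain k where k: "N - a * x - b * y - c * z = M * k" by auto
    have "k < 0"
    proof (rule ccontr)
      assume "\<not> k < 0"
      \<comment> \<open>A nonnegative multiple \<open>M * k = a * (b * c * k)\<close> can be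
        absorbed into the coefficient of \<open>a\<close>.\<close>
      then have "0 \<le> x + b * c * k" using bnd pos by simp
      moreover have "N = a * (x + b * c * k) + b * y + c * z"
        using k by (simp add: M_def algebra_simps)
      ultimately show False using unrepresentable bnd by blast
    qed
    moreover have "- 3 < k"
    proof (rule ccontr)
      assume "\<not> - 3 < k"
      then have "M * k \<le> M * (- 3)" using \<open>0 < M\<close> by (intro mult_left_mono) auto
      moreover have "a * x \<le> a * (b * c - 1)" "b * y \<le> b * (c * a - 1)" "c * z \<le> c * (a * b - 1)"
        using bnd pos by (simp_all add: mult_left_mono)
      ultimately show False using k pos \<open>0 \<le> N\<close> by (simp add: M_def algebra_simps)
    qed
    ultimately have "2 * k + 3 = 1 \<or> 2 * k + 3 = - 1" by arith
    then have "(2 * k + 3)^2 = 1" by (metis power_one power2_minus)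
    \<comment> \<open>The three centrings contribute \<open>3 * M - (a + b + c)\<close>; the summand
      \<open>a + b + c\<close> of \<open>\<tau>\<close> cancels the rest.\<close>
    moreover have "\<tau> - a * ?X x - b * ?Y y - c * ?Z z = (2 * k + 3) * M"
      using k by (simp add: \<tau>_def centred_def M_def algebra_simps)
    ultimately show ?thesis by (simp add: power_mult_distrib)
  qed
  then have "?S (\<lambda>x y z. (\<tau> - a * ?X x - b * ?Y y - c * ?Z z)^2) = ?S (\<lambda>_ _ _. M^2 * 1)"
    by (intro sum.cong) auto
  also have "\<dots> = M^2 * ?S (\<lambda>_ _ _. 1)"
    by (simp add: case_prod_beta)
  also have "\<dots> = M^3"
    unfolding one by (simp add: power2_eq_square power3_eq_cube)
  \<comment> \<open>The factor \<open>1\<close> is kept so that the constant term becomes a multiple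
    of the number of solutions.\<close>
  also have "?S (\<lambda>x y z. (\<tau> - a * ?X x - b * ?Y y - c * ?Z z)^2) =
      ?S (\<lambda>x y z. \<tau>^2 * 1 - 2 * \<tau> * a * ?X x - 2 * \<tau> * b * ?Y y - 2 * \<tau> * c * ?Z z
        + a^2 * (?X x)^2 + b^2 * (?Y y)^2 + c^2 * (?Z z)^2
        + 2 * (a * b) * (?X x * ?Y y) + 2 * (b * c) * (?Y y * ?Z z) + 2 * (c * a) * (?Z z * ?X x))"
    by (intro sum.cong refl) (auto simp: power2_eq_square algebra_simps)
  also have "\<dots> = \<tau>^2 * ?S (\<lambda>_ _ _. 1) - 2 * \<tau> * a * ?S (\<lambda>x y z. ?X x)
        - 2 * \<tau> * b * ?S (\<lambda>x y z. ?Y y) - 2 * \<tau> * c * ?S (\<lambda>x y z. ?Z z)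
        + a^2 * ?S (\<lambda>x y z. (?X x)^2) + b^2 * ?S (\<lambda>x y z. (?Y y)^2) + c^2 * ?S (\<lambda>x y z. (?Z z)^2)
        + 2 * (a * b) * ?S (\<lambda>x y z. ?X x * ?Y y) + 2 * (b * c) * ?S (\<lambda>x y z. ?Y y * ?Z z)
        + 2 * (c * a) * ?S (\<lambda>x y z. ?Z z * ?X x)"
    unfolding case_prod_beta sum.distrib sum_subtractf sum_distrib_left by simp
  finally have expanded: "\<tau>^2 * M + a^2 * ?S (\<lambda>x y z. (?X x)^2) + b^2 * ?S (\<lambda>x y z. (?Y y)^2)
        + c^2 * ?S (\<lambda>x y z. (?Z z)^2)
        + 2 * (a * b) * ?S (\<lambda>x y z. ?X x * ?Y y) + 2 * (b * c) * ?S (\<lambda>x y z. ?Y y * ?Z z)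
        + 2 * (c * a) * ?S (\<lambda>x y z. ?Z z * ?X x) = M^3"
    unfolding one lin by simp
  \<comment> \<open>Three times \<open>expanded\<close>, with exact squares and lower bounds for the
    mixed sums. The cubes \<open>M^3\<close> cancel, and
    \<open>a^2 + b^2 + c^2 - 2 * (a * b + b * c + c * a)\<close> supplies the coefficient
    \<open>-4\<close> after completing \<open>(a + b + c)^2\<close>.\<close>
  have "3 * \<tau>^2 * M + M * (M^2 - a^2) + M * (M^2 - b^2) + M * (M^2 - c^2)
      - 2 * (M * (M * c - a * b)) - 2 * (M * (M * a - b * c)) - 2 * (M * (M * b - c * a)) \<le> 3 * M^3"
    using expanded sq mixed by linarith
  then have "M * (3 * \<tau>^2) \<le> M * ((a + b + c)^2 + 2 * M * (a + b + c) - 4 * (a * b + b * c + c * a))"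
    by (simp add: power2_eq_square power3_eq_cube algebra_simps)
  then have "3 * \<tau>^2 \<le> (a + b + c)^2 + 2 * M * (a + b + c) - 4 * (a * b + b * c + c * a)"
    using \<open>0 < M\<close> by simp
  then show ?thesis by (simp add: \<tau>_def M_def algebra_simps)
qed

section \<open>Passage to the Frobenius number\<close>

text \<open>Cutting the set off below at the witness \<open>k\<close> leaves a finite nonempty set,
  whose maximum is the greatest element of the whole.\<close>

lemma GreatestI_bounded_int:
  fixes P :: "int \<Rightarrow> bool"
  assumes "P k" and "\<And>y. P y \<Longrightarrow> y \<le> B"
  shows "P (GREATEST x. P x)"
proof -
  let ?A = "{x. P x \<and> k \<le> x}"
  have fin: "finite ?A" by (rule finite_subset[of _ "{k..B}"]) (use assms(2) in auto)
  have "k \<in> ?A" using assms(1) by simp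
  then have ne: "?A \<noteq> {}" by blast
  have "Max ?A \<in> ?A" using Max_in[OF fin ne] .
  moreover have "y \<le> Max ?A" if "P y" for y
  proof (cases "k \<le> y")
    case True
    then show ?thesis using that fin by (intro Max_ge) auto
  next
    case False
    then show ?thesis using \<open>Max ?A \<in> ?A\<close> by simp
  qed
  ultimately have "P (Max ?A)" "\<And>y. P y \<Longrightarrow> y \<le> Max ?A" by auto
  then show ?thesis by (rule GreatestI2_order)
qed

text \<open>The target inequality at the value \<open>-1\<close>, which
  \<open>unrepresentable_bound\<close> does not cover. It follows from \<open>s \<le> M + 2\<close>,
  multiplied by \<open>s\<close>, together with \<open>3 \<le> s \<le> E\<close>.\<close>

lemma minus_one_bound:
  fixes a b c :: int
  assumes "0 < a" "0 < b" "0 < c"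
  shows "3 * (- 2 + a + b + c)^2 \<le>
    (a + b + c)^2 + 2 * (a * b * c) * (a + b + c) + 8 * (a * b + b * c + c * a)"
proof -
  define i j k where "i = a - 1" "j = b - 1" "k = c - 1"
  then have abc: "a = i + 1" "b = j + 1" "c = k + 1" and ijk: "0 \<le> i" "0 \<le> j" "0 \<le> k"
    using assms by simp_all
  then have prods: "0 \<le> i * j" "0 \<le> j * k" "0 \<le> i * k" "0 \<le> i * (j * k)" by simp_all
  define s M E where "s = a + b + c" and "M = a * b * c" and "E = a * b + b * c + c * a"
  note defs = s_def M_def E_def abc
  \<comment> \<open>In the shifted variables,
    \<open>M + 2 - s = i * j + j * k + i * k + i * j * k\<close>.\<close>
  have "s \<le> M + 2"
    using prods by (simp add: defs algebra_simps)
  moreover have "3 \<le> s" using assms by (simp add: s_def)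
  ultimately have "s * s \<le> (M + 2) * s" by (intro mult_right_mono) auto
  then have "s * s \<le> M * s + 2 * s" by (simp add: algebra_simps)
  moreover have "s \<le> E"
    using ijk prods by (simp add: defs algebra_simps)
  moreover have "3 * (- 2 + s)^2 = 3 * (s * s) - 12 * s + 12"
    by (simp add: power2_eq_square algebra_simps)
  ultimately have "3 * (- 2 + s)^2 \<le> s * s + 2 * (M * s) + 8 * E"
    using \<open>3 \<le> s\<close> by linarith
  then have "3 * (- 2 + s)^2 \<le> s^2 + 2 * M * s + 8 * E"
    by (simp add: power2_eq_square)
  moreover have "- 2 + a + b + c = - 2 + s" by (simp add: s_def)
  ultimately show ?thesis
    by (simp only: s_def[symmetric] M_def[symmetric] E_def[symmetric])
qed

theorem theorem1:
  fixes n :: nat and a :: "nat \<Rightarrow> nat"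
  assumes "n \<ge> 3"
    and "\<And>i. i \<in> {1..n} \<Longrightarrow> 0 < a i"
    and "\<And>i j. i \<in> {1..n} \<Longrightarrow> j \<in> {1..n} \<Longrightarrow> i \<le> j \<Longrightarrow> a i \<le> a j"
    and "\<And>i j. i \<in> {1..n} \<Longrightarrow> j \<in> {1..n} \<Longrightarrow> i \<noteq> j \<Longrightarrow> gcd (a i) (a j) = 1"
  shows "real_of_int (frobenius_number n a) \<le>
    1 / 2 * (sqrt (1 / 3 * (real (a 1) + real (a 2) + real (a 3))
                         * (real (a 1) + real (a 2) + real (a 3)
                            + 2 * real (a 1) * real (a 2) * real (a 3))
                   + 8 / 3 * (real (a 1) * real (a 2) + real (a 2) * real (a 3)
                              + real (a 3) * real (a 1)))
             - real (a 1) - real (a 2) - real (a 3))"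
proof -
  define p q r where pqr: "p = int (a 1)" "q = int (a 2)" "r = int (a 3)"
  have pos: "0 < p" "0 < q" "0 < r" using assms(1,2) by (auto simp: pqr)
  have "coprime (a 1) (a 2)" "coprime (a 2) (a 3)" "coprime (a 3) (a 1)"
    using assms(1) assms(4)[of 1 2] assms(4)[of 2 3] assms(4)[of 3 1] by (auto simp: coprime_iff_gcd_eq_1)
  then have coprime: "coprime p q" "coprime q r" "coprime r p" by (simp_all add: pqr)
  \<comment> \<open>Three times the radicand of the claim. Its coefficient \<open>8\<close> replaces
    the sharper \<open>-4\<close> available for nonnegative values.\<close>
  define C where "C = (p + q + r)^2 + 2 * (p * q * r) * (p + q + r) + 8 * (p * q + q * r + r * p)"
  define P where "P b \<longleftrightarrow> (\<forall>z :: nat \<Rightarrow> nat. b \<noteq> int (\<Sum>i = 1..n. a i * z i))" for b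
  have rep: "\<not> P (p * x + q * y + r * w)" if "0 \<le> x" "0 \<le> y" "0 \<le> w" for x y w
  proof -
    \<comment> \<open>All generators beyond the third get coefficient zero, so an integer
      unrepresentable by all generators is unrepresentable by the first three.\<close>
    define z where "z = (\<lambda>_ :: nat. 0)(1 := nat x, 2 := nat y, 3 := nat w)"
    have "(\<Sum>i = 1..n. a i * z i) = (\<Sum>i\<in>{1, 2, 3}. a i * z i)"
      using assms(1) by (intro sum.mono_neutral_right) (auto simp: z_def)
    also have "\<dots> = a 1 * nat x + a 2 * nat y + a 3 * nat w" by (simp add: z_def)
    finally have "int (\<Sum>i = 1..n. a i * z i) = p * x + q * y + r * w"
      using that by (simp add: pqr)
    then show ?thesis unfolding P_def by metis
  qed
  have bound: "b < 0 \<or> 3 * (2 * b + p + q + r)^2 \<le> C" if "P b" for b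
  proof (cases "b < 0")
    case False
    have "3 * (2 * b + p + q + r)^2 \<le>
        (p + q + r)^2 + 2 * (p * q * r) * (p + q + r) - 4 * (p * q + q * r + r * p)"
      using that rep False by (intro unrepresentable_bound pos coprime) auto
    also have "\<dots> \<le> C" using pos by (simp add: C_def)
    finally show ?thesis by simp
  qed simp
  have "- 1 \<noteq> int m" for m by simp
  then have "P (- 1)" unfolding P_def by blast
  have "C > 0" using pos by (simp add: C_def add_pos_pos)
  \<comment> \<open>A crude upper bound, serving only to ensure that the greatest element
    exists.\<close>
  have le: "b \<le> C" if "P b" for b
  proof (cases "b < 0")
    case False
    then have "b \<le> b * b" by (cases "b = 0") (auto simp: mult_le_cancel_left1)
    also have "\<dots> \<le> (2 * b + p + q + r)^2"
      using False pos unfolding power2_eq_square by (intro mult_mono) auto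
    also have "\<dots> \<le> 3 * (2 * b + p + q + r)^2" by simp
    also have "\<dots> \<le> C" using bound that False by blast
    finally show ?thesis .
  qed (use \<open>C > 0\<close> in simp)
  define F where "F = frobenius_number n a"
  have F: "F = (GREATEST b. P b)" by (simp add: F_def frobenius_number_def P_def)
  have "P F" unfolding F using \<open>P (- 1)\<close> le by (rule GreatestI_bounded_int)
  have "3 * (2 * F + p + q + r)^2 \<le> C \<or> F \<le> - 1"
    using bound[OF \<open>P F\<close>] by auto
  moreover have "3 * (- 2 + p + q + r)^2 \<le> C"
    unfolding C_def using pos by (rule minus_one_bound)
  \<comment> \<open>\<open>G\<close> is \<open>F\<close> itself if the quadratic bound holds there,
    and \<open>-1\<close> otherwise. Replacing \<open>F\<close> by the larger \<open>G\<close> is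
    harmless, as the claim bounds \<open>F\<close> from above.\<close>
  ultimately obtain G where G: "F \<le> G" "3 * (2 * G + p + q + r)^2 \<le> C"
    by (metis mult_minus1_right order_refl)
  have "3 * (2 * real_of_int G + p + q + r)^2 \<le> real_of_int C"
    using G(2) by (metis (mono_tags, lifting) of_int_add of_int_le_iff of_int_mult of_int_numeral of_int_power)
  then have "2 * real_of_int G + p + q + r \<le> sqrt (real_of_int C / 3)"
    by (intro real_le_rsqrt) simp
  moreover have "real_of_int C / 3 = 1 / 3 * (real (a 1) + real (a 2) + real (a 3))
                         * (real (a 1) + real (a 2) + real (a 3)
                            + 2 * real (a 1) * real (a 2) * real (a 3))
                   + 8 / 3 * (real (a 1) * real (a 2) + real (a 2) * real (a 3)
                              + real (a 3) * real (a 1))"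
    by (simp add: C_def pqr power2_eq_square field_simps)
  ultimately show ?thesis using G(1) by (simp add: F_def pqr)
qed

end
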